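(* Let $n\geq 2$ be an integer and write $n=2^{r_0}\, p_1^{r_1}\cdots p_t^{r_t}$, where $t\ge 0$, $r_0$ is a nonnegative integer, $r_1,\dots,r_t$ are positive integers, and $p_1,\dots,p_t$ are distinct odd prime numbers. Then the following statements hold. (i) If $r_0\in\{0,1\}$, then $|\mathrm{Inv}(\mathbb{Z}_n[x])|=2^t$. Moreover, the graph $\mathcal{G}(\mathbb{Z}_n[x])$ is an infinite disjoint union of subgraphs isomorphic to $\mathcal{G}(\mathbb{Z}_n)$. (ii) If $r_0\geq 2$, then $\mathrm{Inv}(\mathbb{Z}_n[x])$ is infinite.
   Context: $\mathbb{Z}_n$ denotes the ring of integers modulo $n$. For a commutative ring $R$ with identity, an element $u\in R$ is an involution if $u^2=1$, and $\mathrm{Inv}(R)$ denotes the set of involutions of $R$. The involutory Cayley graph $\mathcal{G}(R)$ is the simple undirected graph with vertex set $R$ in which two vertices $a,b$ are adjacent if and only if $(a-b)^2=1$. In (i), "disjoint union" is the disjoint union of graphs (no edges between different pieces). *)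

theory Defs
  imports
    "HOL-Algebra.UnivPoly"
    "HOL-Number_Theory.Residues"
    "Graph_Theory.Graph_Theory"
begin

definition involutions :: "('a, 'm) ring_scheme \<Rightarrow> 'a set"
  where "involutions R = {u \<in> carrier R. u [^]\<^bsub>R\<^esub> (2::nat) = \<one>\<^bsub>R\<^esub>}"

text \<open>
  An undirected edge is represented, as usual in the graph library, by the two arcs
  \<open>(a, b)\<close> and \<open>(b, a)\<close>. The conjunct \<open>a \<noteq> b\<close> makes the graph loop-free also over the zero
  ring; over any other ring it follows from the equation.
\<close>

definition involutory_Cayley_graph :: "('a, 'm) ring_scheme \<Rightarrow> ('a, 'a \<times> 'a) pre_digraph"
  where "involutory_Cayley_graph R =
    \<lparr>verts = carrier R,
     arcs = {(a, b). a \<in> carrier R \<and> b \<in> carrier R \<and> a \<noteq> b \<and>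
               (a \<ominus>\<^bsub>R\<^esub> b) [^]\<^bsub>R\<^esub> (2::nat) = \<one>\<^bsub>R\<^esub>},
     tail = fst,
     head = snd\<rparr>"

text \<open>
  The absence of edges between different pieces is part of the last conjunct: every arc
  of \<open>G\<close> is an arc of one of the pieces.
\<close>

definition is_disjoint_union :: "('a, 'b) pre_digraph \<Rightarrow> ('a, 'b) pre_digraph set \<Rightarrow> bool"
  where "is_disjoint_union G Hs \<longleftrightarrow>
    (\<forall>H\<in>Hs. subgraph H G) \<and>
    pairwise (\<lambda>H K. verts H \<inter> verts K = {}) Hs \<and>
    pre_digraph.Union G Hs = G"

lemma involutory_Cayley_graph_simple:
  assumes "cring R"
  shows "loopfree_digraph (involutory_Cayley_graph R)"
    and "nomulti_digraph (involutory_Cayley_graph R)"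
    and "sym_digraph (involutory_Cayley_graph R)"
proof -
  interpret cring R by fact
  show "loopfree_digraph (involutory_Cayley_graph R)"
    by unfold_locales (auto simp: involutory_Cayley_graph_def)
  show "nomulti_digraph (involutory_Cayley_graph R)"
    by unfold_locales (auto simp: involutory_Cayley_graph_def arc_to_ends_def)
  have sq: "(b \<ominus>\<^bsub>R\<^esub> a) [^]\<^bsub>R\<^esub> (2::nat) = (a \<ominus>\<^bsub>R\<^esub> b) [^]\<^bsub>R\<^esub> (2::nat)"
    if "a \<in> carrier R" "b \<in> carrier R" for a b
  proof -
    have "b \<ominus>\<^bsub>R\<^esub> a = \<ominus>\<^bsub>R\<^esub> (a \<ominus>\<^bsub>R\<^esub> b)"
      using that by (simp add: a_minus_def minus_add a_comm)
    then show ?thesis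
      using that by (simp add: numeral_2_eq_2 l_minus r_minus)
  qed
  show "sym_digraph (involutory_Cayley_graph R)"
    by unfold_locales
      (auto simp: involutory_Cayley_graph_def arc_to_ends_def arcs_ends_def
         symmetric_def sym_def sq)
qed

end

theory Submission
  imports Defs
begin

text \<open>
  Everything rests on one dichotomy for the polynomial ring over the integers modulo \<open>n\<close>.

  If \<open>4\<close> does not divide \<open>n\<close>, every involution is a constant. The coefficients are killed one
  after the other: once those between the constant term \<open>c\<close> and \<open>x\<^sup>k\<close> vanish, the coefficient of
  \<open>x\<^sup>k\<close> in the square is \<open>2 c a\<^sub>k\<close>, where \<open>c\<close> is a unit because \<open>c\<^sup>2 = 1\<close>. So \<open>2 a\<^sub>k = 0\<close>, which
  settles odd \<open>n\<close>. For even \<open>n\<close> the coefficient of \<open>x\<close> to the power \<open>2 k\<close>, which is congruent to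
  \<open>a\<^sub>k\<^sup>2\<close> modulo \<open>2\<close>, shows that \<open>a\<^sub>k\<close> is even as well; as \<open>n / 2\<close> is odd, again \<open>a\<^sub>k = 0\<close>. This is
  \<open>square_root_of_1_constant\<close>. It reduces the count of involutions to the count of square roots
  of \<open>1\<close> modulo \<open>n\<close>: by the Chinese remainder theorem each odd prime power contributes the two
  roots \<open>1\<close> and \<open>-1\<close>, and a single factor \<open>2\<close> contributes one root.

  The shape of the graph follows from the same fact. Two adjacent polynomials differ by an
  involution, hence by a constant, so every edge stays inside one coset of the constants. Inside
  a coset, translation identifies the induced graph with the graph of the coefficient ring. The
  cosets of the powers of \<open>x\<close> are pairwise distinct, so there are infinitely many.

  If \<open>4\<close> divides \<open>n\<close>, then \<open>c = n / 2\<close> satisfies \<open>2 c = 0\<close> and \<open>c\<^sup>2 = 0\<close>, and \<open>1 + c x\<^sup>j\<close> is an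
  involution for every \<open>j\<close>.
\<close>

section \<open>Power series squaring to one modulo n\<close>

lemma coprime_if_square_cong_1:
  fixes a m :: int
  assumes "[a * a = 1] (mod m)"
  shows "coprime a m"
  using assms coprime_iff_invertible_int by blast

lemma sum_antidiagonal_ends:
  fixes a :: "nat \<Rightarrow> int"
  assumes "0 < k"
  shows "(\<Sum>i\<le>k. a i * a (k - i)) = 2 * (a 0 * a k) + (\<Sum>i\<in>{0<..<k}. a i * a (k - i))"
proof -
  have "{..k} = insert 0 (insert k {0<..<k})" using assms by auto
  then show ?thesis using assms by simp
qed

lemma sum_antidiagonal_middle:
  fixes a :: "nat \<Rightarrow> int"
  shows "(\<Sum>i\<le>2 * k. a i * a (2 * k - i)) = a k * a k + 2 * (\<Sum>i<k. a i * a (2 * k - i))"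
proof -
  have split: "{..2 * k} = {..<k} \<union> insert k {k<..2 * k}" by auto
  have "(\<Sum>i\<le>2 * k. a i * a (2 * k - i)) =
      (\<Sum>i<k. a i * a (2 * k - i)) + (a k * a k + (\<Sum>i\<in>{k<..2 * k}. a i * a (2 * k - i)))"
    unfolding split by (subst sum.union_disjoint) auto
  moreover have "(\<Sum>i\<in>{k<..2 * k}. a i * a (2 * k - i)) = (\<Sum>i<k. a i * a (2 * k - i))"
    by (rule sum.reindex_bij_witness[of _ "\<lambda>i. 2 * k - i" "\<lambda>i. 2 * k - i"]) (auto simp: mult.commute)
  ultimately show ?thesis by simp
qed

text \<open>
  The power series with coefficients \<open>a\<close> squares to \<open>1\<close> modulo \<open>m\<close>. The coefficient of index \<open>k\<close>
  of the square shows that \<open>m\<close> divides \<open>2 * a k\<close>. If \<open>m\<close> is even, the one of index \<open>2 * k\<close> shows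
  that \<open>a k\<close> is even: its terms away from the diagonal come in equal pairs, so only
  \<open>a k * a k\<close> survives modulo \<open>2\<close>.
\<close>

lemma square_root_of_1_constant:
  fixes a :: "nat \<Rightarrow> int" and m :: int
  assumes "\<not> 4 dvd m"
    and sq: "\<And>k. [(\<Sum>i\<le>k. a i * a (k - i)) = (if k = 0 then 1 else 0)] (mod m)"
    and "0 < k"
  shows "m dvd a k"
  using \<open>0 < k\<close>
proof (induction k rule: less_induct)
  case (less k)
  have "coprime (a 0) m"
    using sq[of 0] by (intro coprime_if_square_cong_1) simp
  have "m dvd (\<Sum>i\<in>{0<..<k}. a i * a (k - i))"
    using less.IH by (intro dvd_sum) simp
  moreover have "m dvd (\<Sum>i\<le>k. a i * a (k - i))"
    using sq[of k] less.prems by (simp add: cong_0_iff)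
  ultimately have "m dvd a 0 * (2 * a k)"
    using less.prems by (simp add: sum_antidiagonal_ends dvd_add_left_iff ac_simps)
  then have two: "m dvd 2 * a k"
    using \<open>coprime (a 0) m\<close> by (simp add: coprime_dvd_mult_right_iff coprime_commute)
  show ?case
  proof (cases "even m")
    case False
    then show ?thesis
      using two by (simp add: coprime_dvd_mult_right_iff)
  next
    case True
    then obtain l where l: "m = 2 * l" by blast
    with \<open>\<not> 4 dvd m\<close> have "odd l" by auto
    have "m dvd (\<Sum>i\<le>2 * k. a i * a (2 * k - i))"
      using sq[of "2 * k"] less.prems by (simp add: cong_0_iff)
    then have "2 dvd a k * a k + 2 * (\<Sum>i<k. a i * a (2 * k - i))"
      unfolding sum_antidiagonal_middle using l by (blast intro: dvd_mult_left)
    then have "2 dvd a k" by simp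
    moreover have "l dvd a k" using two l by simp
    ultimately show ?thesis
      using \<open>odd l\<close> l by (simp add: divides_mult)
  qed
qed

section \<open>Counting square roots of one modulo n\<close>

definition sqrts_of_1_mod :: "nat \<Rightarrow> nat set"
  where "sqrts_of_1_mod n = {x. x < n \<and> [x ^ 2 = 1] (mod n)}"

text \<open>
  By the Chinese remainder theorem a square root of \<open>1\<close> modulo \<open>m * n\<close> amounts to a pair of
  square roots modulo the two coprime factors.
\<close>

lemma card_sqrts_of_1_mod_mult:
  assumes "coprime m n" "0 < m" "0 < n"
  shows "card (sqrts_of_1_mod (m * n)) = card (sqrts_of_1_mod m) * card (sqrts_of_1_mod n)"
proof -
  have "bij_betw (\<lambda>x. (x mod m, x mod n))
      (sqrts_of_1_mod (m * n)) (sqrts_of_1_mod m \<times> sqrts_of_1_mod n)"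
    unfolding bij_betw_def
  proof
    show "inj_on (\<lambda>x. (x mod m, x mod n)) (sqrts_of_1_mod (m * n))"
    proof (intro inj_onI, clarify)
      fix x y assume "x \<in> sqrts_of_1_mod (m * n)" "y \<in> sqrts_of_1_mod (m * n)"
        and "x mod m = y mod m" "x mod n = y mod n"
      then show "x = y"
        using coprime_cong_mult_nat[of x y m n] assms
        by (auto simp: sqrts_of_1_mod_def cong_def)
    qed
  next
    have roots: "[x ^ 2 = 1] (mod m * n) \<longleftrightarrow>
        [(x mod m) ^ 2 = 1] (mod m) \<and> [(x mod n) ^ 2 = 1] (mod n)" for x
    proof -
      have "[x ^ 2 = 1] (mod m * n) \<longleftrightarrow> [x ^ 2 = 1] (mod m) \<and> [x ^ 2 = 1] (mod n)"
        using assms(1) by (metis coprime_cong_mult_nat cong_modulus_mult_nat mult.commute)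
      then show ?thesis by (simp add: cong_def power_mod)
    qed
    show "(\<lambda>x. (x mod m, x mod n)) ` sqrts_of_1_mod (m * n) =
        sqrts_of_1_mod m \<times> sqrts_of_1_mod n" (is "?f ` _ = _")
    proof
      show "?f ` sqrts_of_1_mod (m * n) \<subseteq> sqrts_of_1_mod m \<times> sqrts_of_1_mod n"
        using assms roots by (auto simp: sqrts_of_1_mod_def)
      show "sqrts_of_1_mod m \<times> sqrts_of_1_mod n \<subseteq> ?f ` sqrts_of_1_mod (m * n)"
      proof clarify
        fix b c assume bc: "b \<in> sqrts_of_1_mod m" "c \<in> sqrts_of_1_mod n"
        obtain x where "x < m * n" "[x = b] (mod m)" "[x = c] (mod n)"
          using binary_chinese_remainder_unique_nat[of m n b c] assms by blast
        with bc roots[of x] show "(b, c) \<in> ?f ` sqrts_of_1_mod (m * n)"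
          by (intro image_eqI[of _ _ x]) (auto simp: sqrts_of_1_mod_def cong_def)
      qed
    qed
  qed
  then show ?thesis
    by (simp add: bij_betw_same_card card_cartesian_product)
qed

text \<open>
  The roots are \<open>1\<close> and \<open>-1\<close>: the odd prime divides at most one of \<open>x - 1\<close> and \<open>x + 1\<close>, because their
  difference is \<open>2\<close>, so the whole prime power divides one of them.
\<close>

lemma card_sqrts_of_1_mod_prime_power:
  fixes p :: nat
  assumes "prime p" "odd p" "0 < k"
  shows "card (sqrts_of_1_mod (p ^ k)) = 2"
proof -
  let ?q = "p ^ k"
  have "2 < p" using assms prime_gt_1_nat[of p] by (cases "p = 2") auto
  then have q: "2 < ?q" using \<open>0 < k\<close> self_le_power[of p k] by linarith
  have "sqrts_of_1_mod ?q = {1, ?q - 1}"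
  proof
    show "sqrts_of_1_mod ?q \<subseteq> {1, ?q - 1}"
    proof
      fix x assume "x \<in> sqrts_of_1_mod ?q"
      then have x: "x < ?q" and "[x ^ 2 = 1] (mod ?q)"
        by (auto simp: sqrts_of_1_mod_def)
      then have "[int x ^ 2 = 1] (mod int ?q)"
        by (metis cong_int_iff of_nat_1 of_nat_power)
      then have prod: "int p ^ k dvd (int x - 1) * (int x + 1)"
        by (simp add: cong_iff_dvd_diff power2_eq_square algebra_simps)
      have "\<not> (int p dvd int x - 1 \<and> int p dvd int x + 1)"
      proof
        assume "int p dvd int x - 1 \<and> int p dvd int x + 1"
        then have "int p dvd (int x + 1) - (int x - 1)" using dvd_diff by blast
        then have "int p dvd 2" by simp
        then show False using \<open>2 < p\<close> zdvd_imp_le[of "int p" 2] by simp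
      qed
      moreover have "prime (int p)" using \<open>prime p\<close> by simp
      ultimately have "coprime (int p ^ k) (int x - 1) \<or> coprime (int p ^ k) (int x + 1)"
        using prime_imp_coprime by (meson coprime_power_left_iff)
      then have "int p ^ k dvd int x - 1 \<or> int p ^ k dvd int x + 1"
        using prod by (auto simp: coprime_dvd_mult_left_iff coprime_dvd_mult_right_iff)
      then show "x \<in> {1, ?q - 1}"
      proof
        assume "int p ^ k dvd int x - 1"
        then have "[int x = int 1] (mod int ?q)" by (simp add: cong_iff_dvd_diff)
        then have "x = 1" using x q unfolding cong_int_iff by (simp add: cong_less_modulus_unique_nat)
        then show ?thesis by simp
      next
        assume "int p ^ k dvd int x + 1"
        then have "?q dvd x + 1" by (metis of_nat_1 of_nat_add of_nat_dvd_iff of_nat_power)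
        then have "?q \<le> x + 1" by (simp add: dvd_imp_le)
        then have "x = ?q - 1" using x by linarith
        then show ?thesis by simp
      qed
    qed
    obtain w where w: "?q = Suc w" using q by (cases ?q) auto
    \<comment> \<open>The natural number \<open>q - 1\<close> represents \<open>-1\<close>, and \<open>(q - 1)\<^sup>2 - 1 = q * (q - 2)\<close>.\<close>
    have "int ?q dvd int ((?q - 1) ^ 2) - int 1"
    proof
      show "int ((?q - 1) ^ 2) - int 1 = int ?q * (int ?q - 2)"
        unfolding w by (simp add: power2_eq_square algebra_simps)
    qed
    then have "[(?q - 1) ^ 2 = 1] (mod ?q)"
      using cong_int_iff cong_iff_dvd_diff by blast
    then show "{1, ?q - 1} \<subseteq> sqrts_of_1_mod ?q"
      using q by (auto simp: sqrts_of_1_mod_def)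
  qed
  then show ?thesis using q by auto
qed

lemma card_sqrts_of_1_mod_prod_prime_powers:
  fixes p r :: "'i \<Rightarrow> nat"
  assumes "finite A" "\<And>i. i \<in> A \<Longrightarrow> 0 < r i" "\<And>i. i \<in> A \<Longrightarrow> prime (p i) \<and> odd (p i)" "inj_on p A"
  shows "card (sqrts_of_1_mod (\<Prod>i\<in>A. p i ^ r i)) = 2 ^ card A"
  using assms
proof (induction A rule: finite_induct)
  case empty
  \<comment> \<open>Modulo \<open>1\<close> the number \<open>0\<close> is a root, so the empty product has one root, as required.\<close>
  have "sqrts_of_1_mod 1 = {0}" by (auto simp: sqrts_of_1_mod_def)
  then show ?case by simp
next
  case (insert j A)
  have pj: "prime (p j)" "odd (p j)" "0 < r j" using insert.prems by auto
  have "coprime (p j ^ r j) (\<Prod>i\<in>A. p i ^ r i)"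
  proof (intro prod_coprime_right)
    fix i assume "i \<in> A"
    then have "prime (p i)" "p i \<noteq> p j" using insert by (auto simp: inj_on_def)
    then show "coprime (p j ^ r j) (p i ^ r i)"
      using pj by (simp add: primes_coprime)
  qed
  moreover have "0 < (\<Prod>i\<in>A. p i ^ r i)"
    using insert.prems by (intro prod_pos) (auto simp: prime_gt_0_nat)
  ultimately have "card (sqrts_of_1_mod (\<Prod>i\<in>insert j A. p i ^ r i)) =
      card (sqrts_of_1_mod (p j ^ r j)) * card (sqrts_of_1_mod (\<Prod>i\<in>A. p i ^ r i))"
    using insert.hyps pj by (simp add: card_sqrts_of_1_mod_mult prime_gt_0_nat)
  then show ?case
    using insert pj by (simp add: card_sqrts_of_1_mod_prime_power)
qed

lemma card_sqrts_of_1_mod_double: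
  assumes "odd m"
  shows "card (sqrts_of_1_mod (2 * m)) = card (sqrts_of_1_mod m)"
proof -
  have "sqrts_of_1_mod 2 = {1}"
    by (auto simp: sqrts_of_1_mod_def cong_def less_2_cases_iff)
  moreover have "0 < m" using assms by (cases m) auto
  ultimately show ?thesis
    using assms by (simp add: card_sqrts_of_1_mod_mult)
qed

lemma card_involutions_residue_ring:
  fixes n :: nat
  assumes "2 \<le> n"
  shows "card (involutions (residue_ring (int n))) = card (sqrts_of_1_mod n)"
proof -
  interpret residues "int n" "residue_ring (int n)"
    by (rule residues.intro) (use assms in simp)
  have pow: "int x [^]\<^bsub>residue_ring (int n)\<^esub> (2::nat) = \<one>\<^bsub>residue_ring (int n)\<^esub> \<longleftrightarrow> [x ^ 2 = 1] (mod n)"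
    if "x < n" for x
  proof -
    have "int x [^]\<^bsub>residue_ring (int n)\<^esub> (2::nat) = int (x ^ 2) mod int n"
    proof -
      have "int x mod int n = int x" using that by simp
      then show ?thesis using pow_cong[of "int x" 2] by (simp only: of_nat_power)
    qed
    moreover have "\<one>\<^bsub>residue_ring (int n)\<^esub> = int 1 mod int n"
      using assms by (simp add: res_one_eq)
    ultimately show ?thesis
      using cong_int_iff[of "x ^ 2" 1 n] by (simp add: cong_def)
  qed
  have "u \<in> involutions (residue_ring (int n)) \<longleftrightarrow> u \<in> int ` sqrts_of_1_mod n" for u
  proof (cases "\<exists>x<n. u = int x")
    case True
    then obtain x where "x < n" "u = int x" by blast
    moreover from this have "u \<in> carrier (residue_ring (int n))"
      by (simp add: res_carrier_eq)
    ultimately show ?thesis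
      using pow[of x] inj_image_mem_iff[OF inj_of_nat, of x "sqrts_of_1_mod n"]
      unfolding involutions_def sqrts_of_1_mod_def mem_Collect_eq by metis
  next
    case False
    then have "\<not> (0 \<le> u \<and> u < int n)" by (metis nat_less_iff nat_0_le)
    then have "u \<notin> carrier (residue_ring (int n))" by (simp add: res_carrier_eq)
    with False show ?thesis
      unfolding involutions_def sqrts_of_1_mod_def by blast
  qed
  then have "involutions (residue_ring (int n)) = int ` sqrts_of_1_mod n" by blast
  then show ?thesis by (simp add: card_image)
qed

section \<open>Cosets of a subring containing all involutions\<close>

lemma arcs_involutory_Cayley_graph:
  assumes "cring R"
  shows "(a, b) \<in> arcs (involutory_Cayley_graph R) \<longleftrightarrow>
    a \<in> carrier R \<and> b \<in> carrier R \<and> a \<noteq> b \<and> a \<ominus>\<^bsub>R\<^esub> b \<in> involutions R"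
proof -
  interpret cring R by fact
  show ?thesis
    by (auto simp: involutory_Cayley_graph_def involutions_def)
qed

lemma wf_digraph_involutory_Cayley_graph: "wf_digraph (involutory_Cayley_graph R)"
  by unfold_locales (auto simp: involutory_Cayley_graph_def)

lemma verts_involutory_Cayley_graph [simp]: "verts (involutory_Cayley_graph R) = carrier R"
  by (simp add: involutory_Cayley_graph_def)

lemma tail_involutory_Cayley_graph [simp]: "tail (involutory_Cayley_graph R) = fst"
  and head_involutory_Cayley_graph [simp]: "head (involutory_Cayley_graph R) = snd"
  by (simp_all add: involutory_Cayley_graph_def)

context ring_hom_cring
begin

lemma abelian_subgroup_image: "abelian_subgroup (h ` carrier R) S"
proof (intro abelian_subgroupI3 additive_subgroup.intro)
  interpret add: group_hom "add_monoid R" "add_monoid S" h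
    by (rule ring.a_group_hom)
  show "subgroup (h ` carrier R) (add_monoid S)"
    using add.subgroup_img_is_subgroup[OF group.subgroup_self[OF R.a_group]] by simp
  show "abelian_group S" by unfold_locales
qed

lemma hom_in_involutions_iff:
  assumes "inj_on h (carrier R)" "u \<in> carrier R"
  shows "h u \<in> involutions S \<longleftrightarrow> u \<in> involutions R"
proof -
  have "h u [^]\<^bsub>S\<^esub> (2::nat) = h (u [^]\<^bsub>R\<^esub> (2::nat))" using assms by simp
  then show ?thesis
    using assms inj_on_eq_iff[OF assms(1), of "u [^]\<^bsub>R\<^esub> (2::nat)" "\<one>\<^bsub>R\<^esub>"]
    by (simp add: involutions_def)
qed

text \<open>
  Adjacency depends on differences only, so the translation \<open>a \<mapsto> h a + x\<close> preserves it; it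
  reflects it because an injective homomorphism reflects involutions.
\<close>

lemma digraph_iso_coset:
  assumes inj: "inj_on h (carrier R)" and x: "x \<in> carrier S"
  shows "digraph_iso (involutory_Cayley_graph S \<restriction> ((h ` carrier R) +>\<^bsub>S\<^esub> x)) (involutory_Cayley_graph R)"
proof -
  let ?G = "involutory_Cayley_graph R" and ?K = "involutory_Cayley_graph S \<restriction> ((h ` carrier R) +>\<^bsub>S\<^esub> x)"
  define t where "t a = h a \<oplus>\<^bsub>S\<^esub> x" for a
  have t_diff: "t a \<ominus>\<^bsub>S\<^esub> t b = h (a \<ominus>\<^bsub>R\<^esub> b)" if "a \<in> carrier R" "b \<in> carrier R" for a b
  proof -
    have "t a \<ominus>\<^bsub>S\<^esub> t b = h a \<oplus>\<^bsub>S\<^esub> (x \<oplus>\<^bsub>S\<^esub> (\<ominus>\<^bsub>S\<^esub> x \<oplus>\<^bsub>S\<^esub> \<ominus>\<^bsub>S\<^esub> h b))"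
      unfolding t_def a_minus_def using that x by (simp add: S.minus_add S.a_ac)
    also have "\<dots> = h a \<ominus>\<^bsub>S\<^esub> h b"
      using that x by (simp add: S.r_neg2 a_minus_def)
    also have "\<dots> = h (a \<ominus>\<^bsub>R\<^esub> b)"
      using that by (simp add: a_minus_def)
    finally show ?thesis .
  qed
  have t_inj: "inj_on t (carrier R)"
    using inj x by (auto simp: inj_on_def t_def)
  have coset: "(h ` carrier R) +>\<^bsub>S\<^esub> x = t ` carrier R"
    by (auto simp: a_r_coset_def' t_def)
  have t_closed: "t a \<in> carrier S" if "a \<in> carrier R" for a
    using that x by (simp add: t_def)
  have arc: "(t a, t b) \<in> arcs (involutory_Cayley_graph S) \<longleftrightarrow> (a, b) \<in> arcs ?G"
    if "a \<in> carrier R" "b \<in> carrier R" for a b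
  proof -
    have "t a \<ominus>\<^bsub>S\<^esub> t b \<in> involutions S \<longleftrightarrow> a \<ominus>\<^bsub>R\<^esub> b \<in> involutions R"
      using that by (simp only: t_diff hom_in_involutions_iff[OF inj] R.minus_closed)
    then show ?thesis
      using that t_closed t_inj R.is_cring S.is_cring
      by (simp add: arcs_involutory_Cayley_graph inj_on_eq_iff)
  qed
  have arcs_carrier: "arcs ?G \<subseteq> carrier R \<times> carrier R"
    by (auto simp: involutory_Cayley_graph_def)
  let ?f = "\<lparr>iso_verts = t, iso_arcs = map_prod t t, iso_head = snd, iso_tail = fst\<rparr>"
  have "pre_digraph.digraph_isomorphism ?G ?f"
    unfolding pre_digraph.digraph_isomorphism_def
    using t_inj wf_digraph_involutory_Cayley_graph
      inj_on_subset[OF map_prod_inj_on[OF t_inj t_inj] arcs_carrier] by auto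
  moreover have "arcs ?K = map_prod t t ` arcs ?G"
  proof
    show "arcs ?K \<subseteq> map_prod t t ` arcs ?G"
      using arc by (auto simp: coset)
    show "map_prod t t ` arcs ?G \<subseteq> arcs ?K"
      using arc arcs_carrier by (auto simp: coset)
  qed
  then have "?K = app_iso ?f ?G"
    by (intro pre_digraph.equality) (simp_all add: coset)
  ultimately have "digraph_iso ?G ?K" by (auto simp: digraph_iso_def)
  then show ?thesis
    by (rule digraph_iso_swap[OF wf_digraph_involutory_Cayley_graph])
qed

text \<open>
  Adjacent vertices differ by an involution, hence by an element of the image of \<open>h\<close>. So no edge
  joins different cosets of the image.
\<close>

lemma is_disjoint_union_cosets:
  assumes "involutions S \<subseteq> h ` carrier R"
  shows "is_disjoint_union (involutory_Cayley_graph S)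
    ((\<restriction>) (involutory_Cayley_graph S) ` (a_rcosets\<^bsub>S\<^esub> (h ` carrier R)))"
proof -
  let ?G = "involutory_Cayley_graph S" and ?I = "h ` carrier R"
  interpret I: abelian_subgroup ?I S by (rule abelian_subgroup_image)
  have sub: "subgraph (?G \<restriction> C) ?G" if "C \<in> a_rcosets\<^bsub>S\<^esub> ?I" for C
  proof -
    have "C \<subseteq> verts ?G" using I.a_rcosets_carrier[OF that] by simp
    then show ?thesis
      using wf_digraph_involutory_Cayley_graph
      by (auto simp: subgraph_def compatible_def intro: wf_digraph.wellformed_induce_subgraph)
  qed
  have disj: "pairwise (\<lambda>H K. verts H \<inter> verts K = {}) ((\<restriction>) ?G ` (a_rcosets\<^bsub>S\<^esub> ?I))"
    unfolding pairwise_image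
    by (rule pairwise_mono[OF I.a_rcos_disjoint]) (simp_all add: disjnt_def)
  have "\<exists>C\<in>a_rcosets\<^bsub>S\<^esub> ?I. (a, b) \<in> arcs (?G \<restriction> C)" if ab: "(a, b) \<in> arcs ?G" for a b
  proof (intro bexI)
    have "a \<in> carrier S" "b \<in> carrier S" "a \<ominus>\<^bsub>S\<^esub> b \<in> ?I"
      using ab assms by (auto simp: arcs_involutory_Cayley_graph[OF S.is_cring])
    then show "(a, b) \<in> arcs (?G \<restriction> (?I +>\<^bsub>S\<^esub> b))"
      using ab I.a_rcos_self[of b] I.a_rcos_module_minus[OF S.ring_axioms, of b a] by simp
    show "?I +>\<^bsub>S\<^esub> b \<in> a_rcosets\<^bsub>S\<^esub> ?I"
      using \<open>b \<in> carrier S\<close> by (intro S.a_rcosetsI) auto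
  qed
  then have "(\<Union>C\<in>a_rcosets\<^bsub>S\<^esub> ?I. arcs (?G \<restriction> C)) = arcs ?G"
    by fastforce
  moreover have "(\<Union>C\<in>a_rcosets\<^bsub>S\<^esub> ?I. verts (?G \<restriction> C)) = verts ?G"
    using I.a_rcosets_part_G by simp
  ultimately have "pre_digraph.Union ?G ((\<restriction>) ?G ` (a_rcosets\<^bsub>S\<^esub> ?I)) = ?G"
    unfolding pre_digraph.Union_def by (intro pre_digraph.equality) simp_all
  with sub disj show ?thesis by (auto simp: is_disjoint_union_def)
qed

end

section \<open>Polynomial rings\<close>

context UP_cring
begin

lemma const_ring_hom_cring: "ring_hom_cring R P (\<lambda>a. monom P a 0)"
  by (intro ring_hom_cring.intro ring_hom_cring_axioms.intro R.is_cring P.is_cring const_ring_hom)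

lemma infinite_cosets_of_constants:
  assumes "\<one> \<noteq> \<zero>"
  shows "infinite (a_rcosets\<^bsub>P\<^esub> ((\<lambda>a. monom P a 0) ` carrier R))" (is "infinite (a_rcosets\<^bsub>P\<^esub> ?C)")
proof -
  interpret const: ring_hom_cring R P "\<lambda>a. monom P a 0" by (rule const_ring_hom_cring)
  interpret C: abelian_subgroup ?C P by (rule const.abelian_subgroup_image)
  \<comment> \<open>The exponents are positive, so a constant does not affect the coefficient compared below.\<close>
  let ?X = "\<lambda>j. monom P \<one> (Suc j)"
  have "inj (\<lambda>j. ?C +>\<^bsub>P\<^esub> ?X j)"
  proof (rule injI, rule ccontr)
    fix i j assume eq: "?C +>\<^bsub>P\<^esub> ?X i = ?C +>\<^bsub>P\<^esub> ?X j" and "i \<noteq> j"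
    have "?X i \<in> ?C +>\<^bsub>P\<^esub> ?X j"
      using C.a_rcos_self[of "?X i"] eq by simp
    then obtain a where "a \<in> carrier R" "?X i = monom P a 0 \<oplus>\<^bsub>P\<^esub> ?X j"
      by (auto simp: a_r_coset_def')
    then have "coeff P (?X i) (Suc i) = coeff P (monom P a 0 \<oplus>\<^bsub>P\<^esub> ?X j) (Suc i)"
      by simp
    then show False
      using \<open>a \<in> carrier R\<close> \<open>i \<noteq> j\<close> assms by simp
  qed
  moreover have "range (\<lambda>j. ?C +>\<^bsub>P\<^esub> ?X j) \<subseteq> a_rcosets\<^bsub>P\<^esub> ?C"
    by (auto intro!: P.a_rcosetsI)
  ultimately show ?thesis
    using range_inj_infinite infinite_super by blast
qed

lemma graph_decomposition_if_involutions_constant: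
  assumes "\<one> \<noteq> \<zero>" "involutions P \<subseteq> (\<lambda>a. monom P a 0) ` carrier R"
  shows "\<exists>Hs. infinite Hs \<and> is_disjoint_union (involutory_Cayley_graph P) Hs \<and>
    (\<forall>H\<in>Hs. digraph_iso H (involutory_Cayley_graph R))"
proof -
  interpret const: ring_hom_cring R P "\<lambda>a. monom P a 0" by (rule const_ring_hom_cring)
  let ?C = "(\<lambda>a. monom P a 0) ` carrier R"
  let ?Hs = "(\<restriction>) (involutory_Cayley_graph P) ` (a_rcosets\<^bsub>P\<^esub> ?C)"
  have "inj ((\<restriction>) (involutory_Cayley_graph P))"
    by (rule injI) (metis induce_subgraph_verts)
  then have "infinite ?Hs"
    using infinite_cosets_of_constants[OF assms(1)] finite_imageD inj_on_subset subset_UNIV by metis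
  moreover have "digraph_iso H (involutory_Cayley_graph R)" if "H \<in> ?Hs" for H
    using that const.digraph_iso_coset[OF monom_inj] by (auto simp: A_RCOSETS_def')
  ultimately show ?thesis
    using const.is_disjoint_union_cosets[OF assms(2)] by blast
qed

lemma card_involutions_if_involutions_constant:
  assumes "involutions P \<subseteq> (\<lambda>a. monom P a 0) ` carrier R"
  shows "card (involutions P) = card (involutions R)"
proof -
  interpret const: ring_hom_cring R P "\<lambda>a. monom P a 0" by (rule const_ring_hom_cring)
  have "involutions P = (\<lambda>a. monom P a 0) ` involutions R"
    using assms const.hom_in_involutions_iff[OF monom_inj]
    by (auto simp: involutions_def)
  moreover have "inj_on (\<lambda>a. monom P a 0) (involutions R)"
    by (rule inj_on_subset[OF monom_inj]) (auto simp: involutions_def)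
  ultimately show ?thesis by (simp add: card_image)
qed

text \<open>
  The square of \<open>1 + c x\<^sup>j\<close> is \<open>1\<close>, since both the mixed term, with coefficient \<open>2 c\<close>, and the last
  term, with coefficient \<open>c\<^sup>2\<close>, vanish.
\<close>

lemma infinite_involutions_if_square_zero:
  assumes c: "c \<in> carrier R" "c \<noteq> \<zero>" "c \<oplus> c = \<zero>" "c \<otimes> c = \<zero>"
  shows "infinite (involutions P)"
proof -
  let ?u = "\<lambda>j. \<one>\<^bsub>P\<^esub> \<oplus>\<^bsub>P\<^esub> monom P c (Suc j)"
  have "?u j \<in> involutions P" for j
  proof -
    let ?m = "monom P c (Suc j)"
    have "?m \<otimes>\<^bsub>P\<^esub> ?m = \<zero>\<^bsub>P\<^esub>" "?m \<oplus>\<^bsub>P\<^esub> ?m = \<zero>\<^bsub>P\<^esub>"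
      using c monom_mult[of c c "Suc j" "Suc j"] monom_add[of c c "Suc j"] by (simp_all del: monom_mult monom_add)
    moreover have "?u j \<otimes>\<^bsub>P\<^esub> ?u j = \<one>\<^bsub>P\<^esub> \<oplus>\<^bsub>P\<^esub> (?m \<oplus>\<^bsub>P\<^esub> ?m) \<oplus>\<^bsub>P\<^esub> ?m \<otimes>\<^bsub>P\<^esub> ?m"
      using c by (simp add: P.l_distr P.r_distr P.a_ac del: monom_mult)
    ultimately have "?u j \<otimes>\<^bsub>P\<^esub> ?u j = \<one>\<^bsub>P\<^esub>" by simp
    then show ?thesis using c by (simp add: involutions_def numeral_2_eq_2)
  qed
  moreover have "inj ?u"
  proof (rule injI, rule ccontr)
    fix i j assume "?u i = ?u j" "i \<noteq> j"
    then have "coeff P (?u i) (Suc i) = coeff P (?u j) (Suc i)" by simp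
    then show False using c \<open>i \<noteq> j\<close> by simp
  qed
  ultimately show ?thesis
    using range_inj_infinite[of ?u] infinite_super[of "range ?u"] by blast
qed

lemma constant_if_coeffs_zero:
  assumes "f \<in> carrier P" "\<And>k. 0 < k \<Longrightarrow> coeff P f k = \<zero>"
  shows "f = monom P (coeff P f 0) 0"
  using assms by (intro up_eqI) auto

end

section \<open>Polynomials over the integers modulo n\<close>

context residues
begin

interpretation UP_cring R "UP R"
  by unfold_locales

lemma coeff_UP_mult_eq_sum_mod:
  assumes "f \<in> carrier (UP R)" "g \<in> carrier (UP R)"
  shows "coeff (UP R) (f \<otimes>\<^bsub>UP R\<^esub> g) k =
    (\<Sum>i\<le>k. coeff (UP R) f i * coeff (UP R) g (k - i)) mod m"
  using assms by (simp add: res_mult_eq sum_cong)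

text \<open>
  Elements of the residue ring are represented by integers in \<open>{0..m - 1}\<close>, so a coefficient
  that is divisible by \<open>m\<close> equals \<open>0\<close>, and the statement on integer sequences applies to the
  representatives.
\<close>

lemma involutions_UP_constant:
  assumes "\<not> 4 dvd m"
  shows "involutions (UP R) \<subseteq> (\<lambda>a. monom (UP R) a 0) ` carrier R"
proof
  fix u assume "u \<in> involutions (UP R)"
  then have u: "u \<in> carrier (UP R)" and sq: "u \<otimes>\<^bsub>UP R\<^esub> u = \<one>\<^bsub>UP R\<^esub>"
    by (auto simp: involutions_def numeral_2_eq_2)
  define a where "a = coeff (UP R) u"
  have "[(\<Sum>i\<le>k. a i * a (k - i)) = (if k = 0 then 1 else 0)] (mod m)" for k
    using coeff_UP_mult_eq_sum_mod[OF u u, of k] m_gt_one unfolding sq a_def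
    by (auto simp: cong_def res_one_eq res_zero_eq split: if_splits)
  then have dvd: "m dvd a k" if "0 < k" for k
    using square_root_of_1_constant[OF assms] that by blast
  have "a k = 0" if "0 < k" for k
  proof -
    have "0 \<le> a k" "a k < m"
      using coeff_closed[OF u, of k] by (auto simp: a_def res_carrier_eq)
    then show ?thesis using dvd[OF that] by (metis mod_pos_pos_trivial dvd_eq_mod_eq_0)
  qed
  then have "u = monom (UP R) (coeff (UP R) u 0) 0"
    using u by (intro constant_if_coeffs_zero) (auto simp: a_def res_zero_eq)
  then show "u \<in> (\<lambda>a. monom (UP R) a 0) ` carrier R"
    using coeff_closed[OF u] by blast
qed

lemma infinite_involutions_UP:
  assumes "4 dvd m"
  shows "infinite (involutions (UP R))"
proof -
  obtain l where l: "m = 4 * l" using assms by blast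
  show ?thesis
  proof (rule infinite_involutions_if_square_zero)
    \<comment> \<open>Here \<open>2 * l\<close> is \<open>m / 2\<close>; its square is \<open>m * l\<close>.\<close>
    show "2 * l \<in> carrier R" "2 * l \<noteq> \<zero>" "2 * l \<oplus> 2 * l = \<zero>"
      using m_gt_one l by (auto simp: res_carrier_eq res_zero_eq res_add_eq)
    show "2 * l \<otimes> (2 * l) = \<zero>"
      by (simp add: res_mult_eq res_zero_eq l)
  qed
qed

end

theorem theorem2p5:
  fixes n t r0 :: nat and p r :: "nat \<Rightarrow> nat"
  assumes "n \<ge> 2"
    and "n = 2 ^ r0 * (\<Prod>i = 1..t. p i ^ r i)"
    and "\<forall>i\<in>{1..t}. r i > 0"
    and "\<forall>i\<in>{1..t}. prime (p i) \<and> odd (p i)"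
    and "inj_on p {1..t}"
  shows "(r0 \<in> {0, 1} \<longrightarrow>
            card (involutions (UP (residue_ring (int n)))) = 2 ^ t \<and>
            (\<exists>Hs. infinite Hs \<and>
                  is_disjoint_union (involutory_Cayley_graph (UP (residue_ring (int n)))) Hs \<and>
                  (\<forall>H\<in>Hs. digraph_iso H (involutory_Cayley_graph (residue_ring (int n)))))) \<and>
         (r0 \<ge> 2 \<longrightarrow> infinite (involutions (UP (residue_ring (int n)))))"
proof -
  let ?R = "residue_ring (int n)" and ?m = "\<Prod>i = 1..t. p i ^ r i"
  interpret residues "int n" ?R
    by (rule residues.intro) (use \<open>n \<ge> 2\<close> in simp)
  interpret UP_cring ?R "UP ?R"
    by unfold_locales
  have "odd ?m"
    using assms(4) by (simp add: even_prod_iff)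
  have "\<one>\<^bsub>?R\<^esub> \<noteq> \<zero>\<^bsub>?R\<^esub>" by (simp add: res_one_eq res_zero_eq)
  show ?thesis
  proof (intro conjI impI)
    assume r0: "r0 \<in> {0, 1}"
    have "\<not> 4 dvd n"
    proof
      assume "4 dvd n"
      moreover have "n dvd 2 * ?m" using r0 assms(2) by auto
      ultimately have "2 * 2 dvd 2 * ?m" using dvd_trans by fastforce
      then show False using \<open>odd ?m\<close> by (subst (asm) dvd_times_left_cancel_iff) auto
    qed
    then have "\<not> 4 dvd int n"
      by (metis of_nat_dvd_iff of_nat_numeral)
    then have const: "involutions (UP ?R) \<subseteq> (\<lambda>a. monom (UP ?R) a 0) ` carrier ?R"
      by (rule involutions_UP_constant)
    have "card (sqrts_of_1_mod n) = card (sqrts_of_1_mod ?m)"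
      using r0 \<open>odd ?m\<close> assms(2) card_sqrts_of_1_mod_double by auto
    also have "\<dots> = 2 ^ t"
      using assms(3-5) by (subst card_sqrts_of_1_mod_prod_prime_powers) auto
    finally show "card (involutions (UP ?R)) = 2 ^ t"
      using card_involutions_if_involutions_constant[OF const]
        card_involutions_residue_ring[OF \<open>n \<ge> 2\<close>] by simp
    show "\<exists>Hs. infinite Hs \<and> is_disjoint_union (involutory_Cayley_graph (UP ?R)) Hs \<and>
        (\<forall>H\<in>Hs. digraph_iso H (involutory_Cayley_graph ?R))"
      by (rule graph_decomposition_if_involutions_constant[OF \<open>\<one>\<^bsub>?R\<^esub> \<noteq> \<zero>\<^bsub>?R\<^esub>\<close> const])
  next
    assume "r0 \<ge> 2"
    then have "2 ^ 2 dvd n" using assms(2) le_imp_power_dvd dvd_mult2 by blast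
    then have "4 dvd int n" by (metis of_nat_dvd_iff of_nat_numeral power2_eq_square num_double numeral_times_numeral)
    then show "infinite (involutions (UP ?R))" by (rule infinite_involutions_UP)
  qed
qed

end
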